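(* For an integer $k\ge 2$, let $M$ be a simple rank-$(k+1)$ matroid (not necessarily representable), and let $(R,B)$ be a 2-colouring of $M$ such that (C1) $r_M(B)\ge 2$; (C2) $H\cap R\ne\emptyset$ for every hyperplane $H$ of $M$; and (C3) for every line $L$ of $M|B$ there is a rank-$(k-1)$ flat $F$ of $M$ skew to $L$ with $F\cap R=\emptyset$. Then $|R|\ge 3$.
   Context: All matroids are finite. A line, hyperplane of a matroid $M$ is a flat of rank $2$, rank $r(M)-1$ respectively. Two sets $X,Y$ are skew in $M$ if $r_M(X\cup Y)=r_M(X)+r_M(Y)$. A 2-colouring of a simple matroid $M$ is a partition $(R,B)$ of $E(M)$ into red elements $R$ and blue elements $B$. *)

theory Defs
  imports Main
begin

record 'a matroid_data =
  ground :: "'a set"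
  indep :: "'a set \<Rightarrow> bool"

locale matroid =
  fixes M :: "'a matroid_data"
  assumes finite_ground: "finite (ground M)"
    and indep_subset_ground: "indep M X \<Longrightarrow> X \<subseteq> ground M"
    and indep_empty: "indep M {}"
    and indep_mono: "\<lbrakk>indep M X; Y \<subseteq> X\<rbrakk> \<Longrightarrow> indep M Y"
    and augmentation:
      "\<lbrakk>indep M X; indep M Y; card Y < card X\<rbrakk> \<Longrightarrow> \<exists>x\<in>X - Y. indep M (insert x Y)"

definition rank :: "'a matroid_data \<Rightarrow> 'a set \<Rightarrow> nat" where
  "rank M X = Max {card Y | Y. Y \<subseteq> X \<and> indep M Y}"

definition circuit :: "'a matroid_data \<Rightarrow> 'a set \<Rightarrow> bool" where
  "circuit M C \<longleftrightarrow> C \<subseteq> ground M \<and> \<not> indep M C \<and> (\<forall>D. D \<subset> C \<longrightarrow> indep M D)"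

(* Neither loops (one-element circuits) nor parallel pairs (two-element circuits). *)
definition simple_matroid :: "'a matroid_data \<Rightarrow> bool" where
  "simple_matroid M \<longleftrightarrow> (\<forall>C. circuit M C \<longrightarrow> card C \<noteq> 1 \<and> card C \<noteq> 2)"

definition flat :: "'a matroid_data \<Rightarrow> 'a set \<Rightarrow> bool" where
  "flat M F \<longleftrightarrow> F \<subseteq> ground M \<and> (\<forall>x\<in>ground M - F. rank M (insert x F) > rank M F)"

definition line :: "'a matroid_data \<Rightarrow> 'a set \<Rightarrow> bool" where
  "line M L \<longleftrightarrow> flat M L \<and> rank M L = 2"

(* Stated additively because subtraction on nat truncates:
   a rank-0 matroid has no hyperplanes. *)
definition hyperplane :: "'a matroid_data \<Rightarrow> 'a set \<Rightarrow> bool" where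
  "hyperplane M H \<longleftrightarrow> flat M H \<and> rank M H + 1 = rank M (ground M)"

definition skew :: "'a matroid_data \<Rightarrow> 'a set \<Rightarrow> 'a set \<Rightarrow> bool" where
  "skew M X Y \<longleftrightarrow> rank M (X \<union> Y) = rank M X + rank M Y"

definition restrict :: "'a matroid_data \<Rightarrow> 'a set \<Rightarrow> 'a matroid_data" where
  "restrict M X = \<lparr>ground = X, indep = (\<lambda>Y. Y \<subseteq> X \<and> indep M Y)\<rparr>"

(* Either colour class may be empty. *)
definition two_colouring :: "'a matroid_data \<Rightarrow> 'a set \<Rightarrow> 'a set \<Rightarrow> bool" where
  "two_colouring M R B \<longleftrightarrow> R \<union> B = ground M \<and> R \<inter> B = {}"

lemma (in matroid) matroid_restrict:
  assumes "X \<subseteq> ground M"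
  shows "matroid (restrict M X)"
proof (unfold_locales, goal_cases)
  case 1
  show ?case using assms finite_ground finite_subset by (auto simp: restrict_def)
next
  case (2 Y)
  then show ?case by (simp add: restrict_def)
next
  case 3
  show ?case by (simp add: restrict_def indep_empty)
next
  case (4 Y Z)
  then show ?case using indep_mono[of Y Z] by (auto simp: restrict_def)
next
  case (5 Y Z)
  then show ?case using augmentation[of Y Z] by (auto simp: restrict_def)
qed

end

(* Suppose R = {x, y}, where x = y is allowed. By (C2) every hyperplane contains x or y, so no
   cocircuit contains both. Lying on a common cocircuit is transitive, so no element z shares a
   cocircuit with x and another one with y. On the other hand, for distinct blue a, b the flat F
   from (C3) gives the hyperplanes cl (F + a) and cl (F + b); each contains x or y, and they cannot
   contain the same one because F is skew to {a, b}. Their complements show that one of a, b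
   shares a cocircuit with x and the other with y. As F contains a third blue element, this
   splits three blue elements into two classes of size at most one, which is absurd. *)
theory Submission
  imports Defs
begin

definition cl :: "'a matroid_data \<Rightarrow> 'a set \<Rightarrow> 'a set" where
  "cl M X = {e \<in> ground M. rank M (insert e X) = rank M X}"

context matroid
begin

section \<open>Rank and bases\<close>

lemma finite_indep: "indep M X \<Longrightarrow> finite X"
  using finite_ground indep_subset_ground finite_subset by blast

lemma finite_indep_cards: "finite {card Y | Y. Y \<subseteq> X \<and> indep M Y}"
proof -
  have "finite (card ` Pow (ground M))" using finite_ground by simp
  then show ?thesis
    by (rule rev_finite_subset) (use indep_subset_ground in blast)
qed

lemma card_le_rank: "\<lbrakk>Y \<subseteq> X; indep M Y\<rbrakk> \<Longrightarrow> card Y \<le> rank M X"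
  unfolding rank_def using finite_indep_cards by (intro Max_ge) blast+

lemma obtain_basis:
  obtains Y where "Y \<subseteq> X" "indep M Y" "card Y = rank M X"
proof -
  have "rank M X \<in> {card Y | Y. Y \<subseteq> X \<and> indep M Y}"
    unfolding rank_def using finite_indep_cards indep_empty by (intro Max_in) auto
  then show ?thesis using that by auto
qed

lemma extend_to_basis:
  assumes "Y \<subseteq> X" "indep M Y"
  obtains Z where "Y \<subseteq> Z" "Z \<subseteq> X" "indep M Z" "card Z = rank M X"
proof -
  have "\<exists>Z. Y \<subseteq> Z \<and> Z \<subseteq> X \<and> indep M Z \<and> card Z = rank M X"
    using assms
  proof (induction "rank M X - card Y" arbitrary: Y)
    case 0
    then show ?case using card_le_rank[of Y X] by (intro exI[of _ Y]) auto
  next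
    case (Suc n)
    obtain Z where Z: "Z \<subseteq> X" "indep M Z" "card Z = rank M X" by (rule obtain_basis)
    moreover have "card Y < card Z" using Suc.hyps(2) Z by simp
    ultimately obtain e where e: "e \<in> Z - Y" "indep M (insert e Y)"
      using augmentation Suc.prems by blast
    have "card (insert e Y) = Suc (card Y)"
      using e finite_indep[OF Suc.prems(2)] by simp
    then have "n = rank M X - card (insert e Y)" using Suc.hyps(2) by simp
    moreover have "insert e Y \<subseteq> X" using e Z Suc.prems by auto
    ultimately obtain W where "insert e Y \<subseteq> W" "W \<subseteq> X" "indep M W" "card W = rank M X"
      using Suc.hyps(1)[of "insert e Y"] e by auto
    then show ?case by auto
  qed
  then show ?thesis using that by blast
qed

lemma rank_mono: "X \<subseteq> Y \<Longrightarrow> rank M X \<le> rank M Y"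
  by (metis obtain_basis card_le_rank subset_trans)

lemma rank_le_insert: "rank M X \<le> rank M (insert e X)"
  by (intro rank_mono) auto

lemma rank_indep: "indep M X \<Longrightarrow> rank M X = card X"
  by (metis obtain_basis card_le_rank card_mono finite_indep le_antisym order_refl)

lemma rank_insert_le: "rank M (insert e X) \<le> rank M X + 1"
proof -
  obtain Y where Y: "Y \<subseteq> insert e X" "indep M Y" "card Y = rank M (insert e X)"
    by (rule obtain_basis)
  have "card (Y - {e}) \<le> rank M X"
    using Y indep_mono[of Y "Y - {e}"] by (intro card_le_rank) auto
  then show ?thesis using Y(3) by (simp add: card_Diff_singleton_if split: if_splits)
qed

text \<open>Submodularity in the form needed for closures. Were the rank of \<open>Y\<close> to
  rise, a basis of \<open>insert e Y\<close> extending a basis \<open>I\<close> of \<open>X\<close>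
  would contain \<open>e\<close>, so \<open>insert e I\<close> would be independent and the rank of
  \<open>X\<close> would rise too.\<close>

lemma rank_insert_eq_mono:
  assumes "rank M (insert e X) = rank M X" "X \<subseteq> Y"
  shows "rank M (insert e Y) = rank M Y"
proof (rule ccontr)
  assume ne: "rank M (insert e Y) \<noteq> rank M Y"
  then have gt: "rank M (insert e Y) > rank M Y"
    using rank_le_insert[of Y e] by linarith
  obtain I where I: "I \<subseteq> X" "indep M I" "card I = rank M X" by (rule obtain_basis)
  obtain J where J: "I \<subseteq> J" "J \<subseteq> insert e Y" "indep M J" "card J = rank M (insert e Y)"
    using extend_to_basis[of I "insert e Y"] I assms(2) by blast
  have "e \<in> J" using J card_le_rank[of J Y] gt by force
  then have "indep M (insert e I)" using J indep_mono by auto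
  then have "card (insert e I) \<le> rank M (insert e X)"
    using I by (intro card_le_rank) auto
  moreover have "e \<notin> I" using ne I assms(2) by (metis insert_absorb subsetD)
  ultimately show False using I finite_indep assms(1) by simp
qed

section \<open>Closure and flats\<close>

lemma cl_subset_ground: "cl M X \<subseteq> ground M"
  by (auto simp: cl_def)

lemma subset_cl: "X \<subseteq> ground M \<Longrightarrow> X \<subseteq> cl M X"
  by (auto simp: cl_def insert_absorb)

lemma cl_mono: "X \<subseteq> Y \<Longrightarrow> cl M X \<subseteq> cl M Y"
  using rank_insert_eq_mono by (auto simp: cl_def)

lemma rank_Un_cl:
  assumes "A \<subseteq> cl M X"
  shows "rank M (X \<union> A) = rank M X"
proof -
  have "finite A" using assms cl_subset_ground finite_ground by (meson finite_subset)
  then show ?thesis using assms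
  proof (induction A)
    case (insert a A)
    then have "rank M (insert a (X \<union> A)) = rank M (X \<union> A)"
      by (intro rank_insert_eq_mono[of a X "X \<union> A", OF _ Un_upper1]) (simp add: cl_def)
    then show ?case using insert by simp
  qed simp
qed

lemma rank_cl: "X \<subseteq> ground M \<Longrightarrow> rank M (cl M X) = rank M X"
  using rank_Un_cl[of "cl M X" X] subset_cl[of X] by (simp add: Un_absorb1)

lemma cl_flat: "flat M F \<Longrightarrow> cl M F = F"
  using subset_cl[of F] by (force simp: flat_def cl_def)

lemma flat_cl:
  assumes "X \<subseteq> ground M"
  shows "flat M (cl M X)"
  unfolding flat_def
proof (intro conjI ballI cl_subset_ground)
  fix e assume e: "e \<in> ground M - cl M X"
  then have "rank M (insert e X) > rank M X"
    using rank_le_insert[of X e] by (force simp: cl_def)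
  also have "rank M (insert e X) \<le> rank M (insert e (cl M X))"
    using subset_cl[OF assms] by (intro rank_mono) auto
  finally show "rank M (insert e (cl M X)) > rank M (cl M X)"
    using rank_cl[OF assms] by simp
qed

lemma cl_subset_flat: "\<lbrakk>flat M F; X \<subseteq> F\<rbrakk> \<Longrightarrow> cl M X \<subseteq> F"
  using cl_mono cl_flat by blast

lemma rank_insert_notin_cl:
  "\<lbrakk>e \<in> ground M; e \<notin> cl M X\<rbrakk> \<Longrightarrow> rank M (insert e X) = rank M X + 1"
  using rank_insert_le[of e X] rank_le_insert[of X e] by (simp add: cl_def)

text \<open>As \<open>f\<close> is spanned by \<open>X\<close> and \<open>e\<close>, adding both
  raises the rank of \<open>X\<close> by at most one, and \<open>f\<close> alone already raises it
  by one.\<close>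

lemma cl_exchange:
  assumes "f \<in> cl M (insert e X)" "f \<notin> cl M X" "e \<in> ground M"
  shows "e \<in> cl M (insert f X)"
proof -
  have "f \<in> ground M" using assms(1) cl_subset_ground by auto
  then have "rank M (insert f X) = rank M X + 1"
    using assms(2) by (rule rank_insert_notin_cl)
  moreover have "rank M (insert e (insert f X)) = rank M (insert e X)"
    using assms(1) by (simp add: cl_def insert_commute)
  ultimately show ?thesis
    using assms(3) rank_insert_le[of e X] rank_le_insert[of "insert f X" e]
    by (auto simp: cl_def)
qed

section \<open>Hyperplanes and elimination\<close>

lemma flat_hyperplane: "hyperplane M H \<Longrightarrow> flat M H"
  by (simp add: hyperplane_def)

lemma hyperplane_subset_ground: "hyperplane M H \<Longrightarrow> H \<subseteq> ground M"
  by (simp add: hyperplane_def flat_def)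

lemma hyperplane_psubset_eq:
  assumes "hyperplane M H" "hyperplane M H'" "H \<subseteq> H'"
  shows "H = H'"
proof (rule ccontr)
  assume "H \<noteq> H'"
  then obtain e where e: "e \<in> H'" "e \<notin> H" using assms(3) by blast
  then have "rank M (insert e H) > rank M H"
    using assms hyperplane_subset_ground by (auto simp: hyperplane_def flat_def)
  moreover have "rank M (insert e H) \<le> rank M H'"
    using e assms(3) by (intro rank_mono) auto
  ultimately show False using assms by (simp add: hyperplane_def)
qed

text \<open>A basis \<open>I\<close> of \<open>G\<close> stays independent when \<open>e\<close> is
  added. Extend \<open>insert e I\<close> to a basis \<open>J\<close> of the matroid; the closure of
  \<open>J - {e}\<close> is the hyperplane.\<close>

lemma obtain_hyperplane_avoiding:
  assumes "G \<subseteq> ground M" "e \<in> ground M" "e \<notin> cl M G"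
  obtains H where "hyperplane M H" "G \<subseteq> H" "e \<notin> H"
proof -
  obtain I where I: "I \<subseteq> G" "indep M I" "card I = rank M G" by (rule obtain_basis)
  have "e \<notin> I" using I assms subset_cl by blast
  have G_cl_I: "G \<subseteq> cl M I"
  proof
    fix g assume "g \<in> G"
    then have "rank M (insert g I) \<le> rank M G" using I by (intro rank_mono) auto
    then show "g \<in> cl M I"
      using \<open>g \<in> G\<close> assms(1) I rank_indep[of I] rank_le_insert[of I g]
      by (auto simp: cl_def)
  qed
  have "rank M (insert e I) = rank M I + 1"
    using assms I cl_mono[of I G] by (intro rank_insert_notin_cl) auto
  moreover obtain K where K: "K \<subseteq> insert e I" "indep M K" "card K = rank M (insert e I)"
    by (rule obtain_basis)
  ultimately have "card K = card (insert e I)"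
    using I rank_indep \<open>e \<notin> I\<close> finite_indep by simp
  then have "indep M (insert e I)"
    using K I finite_indep by (metis card_subset_eq finite_insert)
  then obtain J where J: "insert e I \<subseteq> J" "J \<subseteq> ground M" "indep M J"
      "card J = rank M (ground M)"
    using extend_to_basis indep_subset_ground by metis
  have J': "indep M (J - {e})" "J - {e} \<subseteq> ground M" using J indep_mono[of J] by auto
  have card_J: "card (J - {e}) + 1 = card J"
    using J finite_indep card_Suc_Diff1[of J e] by simp
  show ?thesis
  proof
    show "hyperplane M (cl M (J - {e}))"
      using J' J card_J flat_cl rank_cl rank_indep by (simp add: hyperplane_def)
    show "G \<subseteq> cl M (J - {e})"
      using G_cl_I cl_mono[of I "J - {e}"] J(1) \<open>e \<notin> I\<close> by blast
    have "insert e (J - {e}) = J" using J by auto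
    then show "e \<notin> cl M (J - {e})"
      using J J' card_J rank_indep by (simp add: cl_def)
  qed
qed

text \<open>Strong cocircuit elimination, written for the complementary hyperplanes.\<close>

lemma hyperplane_elimination:
  assumes "hyperplane M H" "hyperplane M H'"
    and "e \<in> ground M" "e \<notin> H \<union> H'" "f \<in> H'" "f \<notin> H"
  obtains H'' where "hyperplane M H''" "insert e (H \<inter> H') \<subseteq> H''" "f \<notin> H''"
proof -
  have "H' \<subseteq> ground M" using assms hyperplane_subset_ground by simp
  \<comment> \<open>Otherwise exchange puts \<open>e\<close> into the closure of \<open>f\<close>
    and \<open>H \<inter> H'\<close>, which stays inside the flat \<open>H'\<close>.\<close>
  have "f \<notin> cl M (insert e (H \<inter> H'))"
  proof
    assume "f \<in> cl M (insert e (H \<inter> H'))"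
    moreover have "f \<notin> cl M (H \<inter> H')"
      using cl_subset_flat[OF flat_hyperplane[OF assms(1)], of "H \<inter> H'"] assms by auto
    ultimately have "e \<in> cl M (insert f (H \<inter> H'))" using cl_exchange assms by simp
    moreover have "cl M (insert f (H \<inter> H')) \<subseteq> H'"
      using assms by (intro cl_subset_flat flat_hyperplane) auto
    ultimately show False using assms by auto
  qed
  moreover have "insert e (H \<inter> H') \<subseteq> ground M" "f \<in> ground M"
    using assms \<open>H' \<subseteq> ground M\<close> by auto
  ultimately show ?thesis
    using obtain_hyperplane_avoiding that by metis
qed

text \<open>Contrapositive of the transitivity of lying on a common cocircuit: a pair of cocircuits
  through \<open>x\<close> and \<open>y\<close> that meet and have the smallest possible union could be
  replaced, by two eliminations, by a pair with smaller union.\<close>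

lemma hyperplanes_cover_ground:
  assumes xy: "\<And>H. hyperplane M H \<Longrightarrow> x \<in> H \<or> y \<in> H"
    and "hyperplane M H" "hyperplane M H'" "x \<notin> H" "y \<notin> H'"
  shows "ground M \<subseteq> H \<union> H'"
  using assms(2-)
proof (induction "card (ground M) - card (H \<inter> H')" arbitrary: H H' rule: less_induct)
  case less
  have sub: "H \<subseteq> ground M" "H' \<subseteq> ground M" using less.prems hyperplane_subset_ground by auto
  \<comment> \<open>The union of the two cocircuits is the complement of
    \<open>H \<inter> H'\<close>, so the measure drops when the intersection grows.\<close>
  have bigger: "ground M \<subseteq> K \<union> K'"
    if "hyperplane M K" "hyperplane M K'" "x \<notin> K" "y \<notin> K'" "H \<inter> H' \<subset> K \<inter> K'" for K K'
  proof (rule less.hyps)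
    have fin: "K \<inter> K' \<subseteq> ground M" "finite (K \<inter> K')"
      using that hyperplane_subset_ground finite_ground by (blast, meson finite_Int finite_subset)
    then have "card (H \<inter> H') < card (K \<inter> K')" using that(5) by (intro psubset_card_mono)
    moreover have "card (K \<inter> K') \<le> card (ground M)"
      using fin finite_ground by (intro card_mono)
    ultimately show "card (ground M) - card (K \<inter> K') < card (ground M) - card (H \<inter> H')"
      by simp
  qed (use that in auto)
  show ?case
  proof (rule ccontr)
    assume "\<not> ground M \<subseteq> H \<union> H'"
    then obtain z where z: "z \<in> ground M" "z \<notin> H \<union> H'" by blast
    have "x \<in> H'" "y \<in> H" using xy less.prems by blast+
    \<comment> \<open>Both eliminations keep \<open>H \<inter> H'\<close> and gain \<open>z\<close>,
      so the induction hypothesis applies to \<open>K\<close> and \<open>K'\<close>.\<close>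
    obtain K where K: "hyperplane M K" "insert z (H \<inter> H') \<subseteq> K" "x \<notin> K"
      using hyperplane_elimination[of H H' z x] z less.prems \<open>x \<in> H'\<close> by blast
    obtain K' where K': "hyperplane M K'" "insert z (H' \<inter> H) \<subseteq> K'" "y \<notin> K'"
      using hyperplane_elimination[of H' H z y] z less.prems \<open>y \<in> H\<close> by blast
    have cover: "ground M \<subseteq> K \<union> K'"
      using K K' z by (intro bigger) auto
    have "\<not> H \<subseteq> K" using hyperplane_psubset_eq[of H K] less.prems K z by blast
    then obtain u where u: "u \<in> H" "u \<notin> K" by blast
    then have "u \<in> K'" "u \<notin> H'" using cover sub K by blast+
    \<comment> \<open>The mixed pair \<open>K\<close>, \<open>H'\<close> is admissible as well. It
      cannot cover the ground set because it misses \<open>u\<close>, so its intersection has not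
      grown; the element \<open>v\<close> found below contradicts this.\<close>
    have disj: "ground M \<subseteq> K \<union> H' \<or> \<not> H \<inter> H' \<subset> K \<inter> H'"
      using bigger[of K H'] K less.prems by blast
    have "H \<inter> H' = K \<inter> H'"
      using disj u \<open>u \<notin> H'\<close> sub K by blast
    have "\<not> H' \<subseteq> K'" using hyperplane_psubset_eq[of H' K'] less.prems K' z by blast
    then obtain v where v: "v \<in> H'" "v \<notin> K'" by blast
    then have "v \<in> K" "v \<notin> H" using cover sub K' by blast+
    then show False using v \<open>H \<inter> H' = K \<inter> H'\<close> by blast
  qed
qed

section \<open>Lines of a restriction and pairs in a simple matroid\<close>

lemma rank_restrict: "X \<subseteq> S \<Longrightarrow> rank (restrict M S) X = rank M X"
proof -
  assume "X \<subseteq> S"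
  then have "{card Y | Y. Y \<subseteq> X \<and> indep (restrict M S) Y} = {card Y | Y. Y \<subseteq> X \<and> indep M Y}"
    by (auto simp: restrict_def)
  then show ?thesis by (simp add: rank_def)
qed

text \<open>(C3) speaks of lines of the blue restriction; this supplies the one through two given
  elements.\<close>

lemma line_restrict_cl:
  assumes "a \<in> S" "b \<in> S" "S \<subseteq> ground M" "rank M {a, b} = 2"
  shows "line (restrict M S) (cl M {a, b} \<inter> S)"
proof -
  let ?L = "cl M {a, b} \<inter> S"
  have ab: "{a, b} \<subseteq> ?L" using assms subset_cl[of "{a, b}"] by auto
  have "rank M ?L \<le> rank M (cl M {a, b})" by (intro rank_mono) auto
  then have rank_L: "rank M ?L = 2"
    using rank_mono[OF ab] rank_cl[of "{a, b}"] assms(1-4) by (metis empty_subsetI insert_subset le_antisym subsetD)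
  have "rank M (insert e ?L) > 2" if "e \<in> S - ?L" for e
    using rank_mono[of "insert e {a, b}" "insert e ?L"] ab that assms
      rank_insert_notin_cl[of e "{a, b}"] by auto
  moreover have "ground (restrict M S) = S" by (simp add: restrict_def)
  ultimately show ?thesis
    using rank_L by (auto simp: line_def flat_def rank_restrict)
qed

lemma simple_indep_pair:
  assumes "simple_matroid M" "a \<in> ground M" "b \<in> ground M"
  shows "indep M {a, b}"
proof -
  have single: "indep M {c}" if "c \<in> ground M" for c
  proof (rule ccontr)
    assume "\<not> indep M {c}"
    moreover have "indep M D" if "D \<subset> {c}" for D
      using that indep_empty by (metis subset_singletonD psubset_eq)
    ultimately have "circuit M {c}" using that by (auto simp: circuit_def)
    then show False using assms(1) by (auto simp: simple_matroid_def)
  qed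
  show ?thesis
  proof (rule ccontr)
    assume dep: "\<not> indep M {a, b}"
    then have "a \<noteq> b" using single assms by auto
    have "indep M D" if "D \<subset> {a, b}" for D
    proof -
      have "D \<subseteq> {a} \<or> D \<subseteq> {b}" using that by blast
      then show ?thesis using single assms indep_mono by blast
    qed
    then have "circuit M {a, b}" using dep assms by (auto simp: circuit_def)
    then show False using assms(1) \<open>a \<noteq> b\<close> by (auto simp: simple_matroid_def)
  qed
qed

section \<open>Hyperplanes through a flat of corank two\<close>

lemma hyperplane_cl_insert:
  assumes "flat M F" "rank M F + 2 = rank M (ground M)" "a \<in> ground M - F"
  shows "hyperplane M (cl M (insert a F))"
proof -
  have "insert a F \<subseteq> ground M" using assms by (auto simp: flat_def)
  moreover have "rank M (insert a F) = rank M F + 1"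
    using assms cl_flat[of F] by (intro rank_insert_notin_cl) auto
  ultimately show ?thesis
    using assms(2) flat_cl rank_cl by (simp add: hyperplane_def)
qed

text \<open>The closures of \<open>insert a F\<close> and \<open>insert b F\<close> meet only in
  \<open>F\<close>, so neither \<open>x\<close> nor \<open>y\<close> lies in both. As each contains
  \<open>x\<close> or \<open>y\<close>, one contains only \<open>x\<close> and the other only
  \<open>y\<close>; moreover each omits one of \<open>a\<close>, \<open>b\<close>.\<close>

lemma separate_pair:
  assumes xy: "\<And>H. hyperplane M H \<Longrightarrow> x \<in> H \<or> y \<in> H"
    and F: "flat M F" "rank M F + 2 = rank M (ground M)" "x \<notin> F" "y \<notin> F"
    and ab: "a \<in> ground M" "b \<in> ground M"
    and span: "rank M (F \<union> {a, b}) = rank M (ground M)"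
  obtains H H' where "hyperplane M H" "hyperplane M H'"
      "x \<notin> H" "y \<notin> H'" "a \<notin> H \<and> b \<notin> H' \<or> b \<notin> H \<and> a \<notin> H'"
proof -
  have not_both: "\<not> {a, b} \<subseteq> cl M (insert c F)" for c
  proof
    assume "{a, b} \<subseteq> cl M (insert c F)"
    then have "rank M (insert c F \<union> {a, b}) = rank M (insert c F)" by (rule rank_Un_cl)
    moreover have "rank M (F \<union> {a, b}) \<le> rank M (insert c F \<union> {a, b})"
      by (intro rank_mono) auto
    ultimately show False using span F rank_insert_le[of c F] by simp
  qed
  have F_ground: "F \<subseteq> ground M" using F by (simp add: flat_def)
  have self: "c \<in> cl M (insert c F)" if "c \<in> ground M" for c
    using subset_cl[of "insert c F"] F_ground that by auto
  have "a \<notin> cl M (insert b F)" "b \<notin> cl M (insert a F)"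
    using not_both[of a] not_both[of b] self ab by auto
  moreover have "F \<subseteq> cl M (insert a F)" "F \<subseteq> cl M (insert b F)"
    using subset_cl[of "insert a F"] subset_cl[of "insert b F"] ab F_ground by auto
  ultimately have notin: "a \<notin> F" "b \<notin> F" by auto
  have hyp: "hyperplane M (cl M (insert a F))" "hyperplane M (cl M (insert b F))"
    using hyperplane_cl_insert F ab notin by auto
  \<comment> \<open>By exchange, a common element \<open>c\<close> outside \<open>F\<close> would
    put both \<open>a\<close> and \<open>b\<close> into the closure of
    \<open>insert c F\<close>.\<close>
  have excl: "\<not> (c \<in> cl M (insert a F) \<and> c \<in> cl M (insert b F))" if "c \<notin> F" for c
    using cl_exchange[of c _ F] cl_flat[OF F(1)] that ab not_both[of c] by auto
  show ?thesis
    using that[OF hyp] that[OF hyp(2,1)] xy[OF hyp(1)] xy[OF hyp(2)] excl F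
      \<open>a \<notin> cl M (insert b F)\<close> \<open>b \<notin> cl M (insert a F)\<close> by blast
qed

end

section \<open>Excluding at most two red elements\<close>

theorem proposition2p3:
  fixes M :: "'a matroid_data" and k :: nat and R B :: "'a set"
  assumes "k \<ge> 2"
    and "matroid M"
    and "simple_matroid M"
    and "rank M (ground M) = k + 1"
    and "two_colouring M R B"
    and C1: "rank M B \<ge> 2"
    and C2: "\<And>H. hyperplane M H \<Longrightarrow> H \<inter> R \<noteq> {}"
    and C3: "\<And>L. line (restrict M B) L \<Longrightarrow>
               \<exists>F. flat M F \<and> rank M F = k - 1 \<and> skew M F L \<and> F \<inter> R = {}"
  shows "card R \<ge> 3"
proof (rule ccontr)
  interpret matroid M by fact
  have ground: "ground M = R \<union> B" using assms(5) by (simp add: two_colouring_def)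
  assume "\<not> card R \<ge> 3"
  obtain Y where Y: "Y \<subseteq> B" "indep M Y" "card Y = rank M B" by (rule obtain_basis)
  have flat_ex: "\<exists>F. flat M F \<and> rank M F + 2 = rank M (ground M) \<and> F \<inter> R = {} \<and>
      rank M (F \<union> {a, b}) = rank M (ground M)" if ab: "a \<in> B" "b \<in> B" "a \<noteq> b" for a b
  proof -
    have rank_ab: "rank M {a, b} = 2"
      using simple_indep_pair assms(3) ab ground rank_indep by auto
    let ?L = "cl M {a, b} \<inter> B"
    have L: "line (restrict M B) ?L"
      using line_restrict_cl ab rank_ab ground by blast
    then obtain F where F: "flat M F" "rank M F = k - 1" "skew M F ?L" "F \<inter> R = {}"
      using C3 by blast
    have "rank M ?L = 2" using L by (simp add: line_def rank_restrict)
    \<comment> \<open>Here \<open>k - 1 + 2\<close> is \<open>k + 1\<close> because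
      \<open>k \<ge> 2\<close> rules out truncation. Since \<open>?L\<close> lies in the closure of
      \<open>{a, b}\<close>, the two elements already span with \<open>F\<close> what the whole line
      does.\<close>
    then have "k + 1 = rank M (F \<union> ?L)" using F assms(1) by (simp add: skew_def)
    also have "rank M (F \<union> ?L) \<le> rank M ((F \<union> {a, b}) \<union> ?L)" by (intro rank_mono) auto
    also have "\<dots> = rank M (F \<union> {a, b})"
      using cl_mono[of "{a, b}" "F \<union> {a, b}"] by (intro rank_Un_cl) auto
    finally have "rank M (ground M) \<le> rank M (F \<union> {a, b})" using assms(4) by simp
    moreover have "F \<union> {a, b} \<subseteq> ground M" using F ab ground by (auto simp: flat_def)
    ultimately have "rank M (F \<union> {a, b}) = rank M (ground M)" using rank_mono by (meson le_antisym)
    then show ?thesis using F assms(1,4) by auto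
  qed
  obtain a b where ab: "a \<in> B" "b \<in> B" "a \<noteq> b"
    using C1 Y by (metis card_2_iff' obtain_subset_with_card_n subsetD)
  obtain F where F: "flat M F" "rank M F + 2 = rank M (ground M)" "F \<inter> R = {}"
      "rank M (F \<union> {a, b}) = rank M (ground M)" using flat_ex ab by blast
  \<comment> \<open>The rank \<open>k - 1\<close> of \<open>F\<close> is positive because
    \<open>k \<ge> 2\<close>.\<close>
  have "F \<noteq> {}" using F assms(1,4) rank_indep[OF indep_empty] by auto
  then obtain f where f: "f \<in> F" by blast
  have "f \<in> B" using f F ground by (auto simp: flat_def)
  \<comment> \<open>If \<open>F\<close> contained one of them, adding the other could not make up
    the rank gap of two.\<close>
  have "a \<notin> F" "b \<notin> F"
    using F(2,4) rank_insert_le[of b F] rank_insert_le[of a F]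
    by (auto simp: insert_absorb insert_commute)
  then have distinct: "f \<noteq> a" "f \<noteq> b" using f by auto
  \<comment> \<open>(C2) yields a red element only once some hyperplane exists; the closure of
    \<open>insert a F\<close> is one.\<close>
  have "R \<noteq> {}"
    using hyperplane_cl_insert[OF F(1,2), of a] C2 \<open>a \<notin> F\<close> ab ground by blast
  moreover have "finite R" using ground finite_ground by simp
  ultimately have "card R = 1 \<or> card R = 2"
    using \<open>\<not> card R \<ge> 3\<close> card_gt_0_iff[of R] by linarith
  then obtain x y where R: "R = {x, y}"
    by (metis card_1_singletonE card_2_iff insert_absorb2)
  have xy: "x \<in> H \<or> y \<in> H" if "hyperplane M H" for H
    using C2[OF that] R by auto
  \<comment> \<open>For elements of the ground set, \<open>P w z\<close> says that they share a
    cocircuit, the complement of \<open>H\<close>.\<close>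
  define P where "P w z \<longleftrightarrow> (\<exists>H. hyperplane M H \<and> w \<notin> H \<and> z \<notin> H)" for w z
  have pair: "P x c \<and> P y d \<or> P x d \<and> P y c" if cd: "c \<in> B" "d \<in> B" "c \<noteq> d" for c d
  proof -
    obtain F where F: "flat M F" "rank M F + 2 = rank M (ground M)" "F \<inter> R = {}"
        "rank M (F \<union> {c, d}) = rank M (ground M)" using flat_ex cd by blast
    show ?thesis
      by (rule separate_pair[OF xy F(1,2) _ _ _ _ F(4)]) (use F R cd ground in \<open>auto simp: P_def\<close>)
  qed
  have "\<not> (P x z \<and> P y z)" if "z \<in> B" for z
    using hyperplanes_cover_ground[OF xy] that ground unfolding P_def by blast
  \<comment> \<open>Each of \<open>a\<close>, \<open>b\<close>, \<open>f\<close> is tied by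
    \<open>P\<close> to exactly one of \<open>x\<close>, \<open>y\<close>, so two of the three are
    tied to the same one, against \<open>pair\<close>.\<close>
  then show False
    using pair[of a b] pair[of a f] pair[of b f] ab distinct \<open>f \<in> B\<close> by blast
qed

end
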